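(* Let $E$ be a real Hausdorff barreled locally convex space, $\mathcal{K}\subset E$ a cone, and $\tau^*$ a locally convex topology on $E^*$ compatible with the dual pair $\langle E,E^*\rangle$. The following are equivalent. (i) $\mathcal{K}^*$ satisfies the weak property $(\pi)$ in $(E^*,\tau^* )$. (ii) $0\in\tau^*\text{-bPC}(\mathcal{K}^* )\cap\sigma(E^*,E)\text{-s-ext}(\mathcal{K}^* )$. (iii) $0\in\tau^*\text{-bPC}(\mathcal{K}^* )$ and $\mathrm{span}(\mathcal{K})$ is dense in $E$. (iv) $0\in\tau^*\text{-bPC}(\mathcal{K}^* )$ and $\mathcal{K}^*$ is pointed. (v) There exist $n\ge1$, $x_i\in\mathcal{K}$ for $i\in\{1,\dots,n\}$, and $\lambda>0$ such that $\bigcap_{i=1}^n\{x^*\in E^*:x^*(x_i)<\lambda\}\cap\mathcal{K}^*$ is ($\tau^*$-)bounded.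
   Context: $E$ is a real Hausdorff locally convex space with dual $E^*$. $E$ is barreled if every barrel (closed, convex, balanced, absorbent set) in $E$ is a neighbourhood of $0$. A locally convex topology $\tau^*$ on $E^*$ is compatible with the dual pair $\langle E,E^*\rangle$ if the dual of $(E^*,\tau^* )$ is $E$ (acting by evaluation), i.e. $\tau^*$ lies between $\sigma(E^*,E)$ and the Mackey topology on $E^*$. A cone $\mathcal{K}$ is a (nonempty) convex set with $\lambda k\in\mathcal{K}$ for all $\lambda\ge0$, $k\in\mathcal{K}$; it is pointed if $\mathcal{K}\cap(-\mathcal{K})=\{0\}$. $\mathcal{K}^*=\{x^*\in E^*: x^*(k)\ge0\ \forall k\in\mathcal{K}\}$. A cone $\mathcal{P}$ in a locally convex space $F$ satisfies the weak property $(\pi)$ if there exist $f\in F^*$, nonnegative on $\mathcal{P}$, and $\alpha>0$ such that $\mathcal{P}\cap\{f\le\alpha\}$ is bounded; thus (i) means there exist $x\in E$ with $x^*(x)\ge0$ for all $x^*\in\mathcal{K}^*$, and $\alpha>0$, such that $\{x^*\in\mathcal{K}^*:x^*(x)\le\alpha\}$ is $\tau^*$-bounded. $0\in\tau^*\text{-bPC}(\mathcal{K}^* )$ means there is a $\sigma(E^*,E)$-neighbourhood $W$ of $0$ such that $\mathcal{K}^*\cap W$ is $\tau^*$-bounded. $0\in\sigma(E^*,E)\text{-s-ext}(\mathcal{K}^* )$ means: for all nets $(c_\gamma)_{\gamma\in\Gamma},(c'_\gamma)_{\gamma\in\Gamma}$ in $\mathcal{K}^*$ with $\lim_\gamma\frac{c_\gamma+c'_\gamma}{2}=0$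 in $\tau^*$, one has $\lim_\gamma c_\gamma=0$ in $\sigma(E^*,E)$. *)

theory Defs
  imports "HOL-Analysis.Analysis"
begin

section \<open>Locally convex spaces\<close>

text \<open>Topologies on a real vector space are given explicitly, since the dual carries several of
  them. A locally convex topology is not assumed to be Hausdorff. The set \<open>U\<close> is a neighbourhood
  of \<open>x\<close> in \<open>T\<close> iff \<open>x \<in> T interior_of U\<close>.\<close>

definition locally_convex_topology :: "'v::real_vector topology \<Rightarrow> bool" where
  "locally_convex_topology T \<longleftrightarrow>
     topspace T = UNIV \<and>
     continuous_map (prod_topology T T) T (\<lambda>(x, y). x + y) \<and>
     continuous_map (prod_topology euclideanreal T) T (\<lambda>(r, x). r *\<^sub>R x) \<and>
     (\<forall>U. 0 \<in> T interior_of U \<longrightarrow> (\<exists>V. V \<subseteq> U \<and> convex V \<and> 0 \<in> T interior_of V))"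

definition tvs_bounded :: "'v::real_vector topology \<Rightarrow> 'v set \<Rightarrow> bool" where
  "tvs_bounded T B \<longleftrightarrow> (\<forall>U. 0 \<in> T interior_of U \<longrightarrow> (\<exists>t>0. B \<subseteq> (\<lambda>x. t *\<^sub>R x) ` U))"

definition balanced :: "'v::real_vector set \<Rightarrow> bool" where
  "balanced B \<longleftrightarrow> (\<forall>x\<in>B. \<forall>r. \<bar>r\<bar> \<le> 1 \<longrightarrow> r *\<^sub>R x \<in> B)"

definition absorbent :: "'v::real_vector set \<Rightarrow> bool" where
  "absorbent B \<longleftrightarrow> (\<forall>x. \<exists>t>0. \<forall>r. \<bar>r\<bar> \<le> t \<longrightarrow> r *\<^sub>R x \<in> B)"

definition barrel :: "'v::real_vector topology \<Rightarrow> 'v set \<Rightarrow> bool" where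
  "barrel T B \<longleftrightarrow> closedin T B \<and> convex B \<and> balanced B \<and> absorbent B"

definition barreled :: "'v::real_vector topology \<Rightarrow> bool" where
  "barreled T \<longleftrightarrow> (\<forall>B. barrel T B \<longrightarrow> 0 \<in> T interior_of B)"

section \<open>The topological dual\<close>

typedef (overloaded) ('a::"{real_vector, topological_space}") cdual =
  "{f :: 'a \<Rightarrow> real. linear f \<and> continuous_on UNIV f}"
  morphisms cdual_apply Abs_cdual
  by (rule exI[of _ "\<lambda>_. 0"]) (auto simp: linear_iff)

setup_lifting type_definition_cdual

instantiation cdual :: ("{real_vector, topological_space}") real_vector
begin

lift_definition zero_cdual :: "'a cdual" is "\<lambda>_. 0"
  by (auto simp: linear_iff)

lift_definition plus_cdual :: "'a cdual \<Rightarrow> 'a cdual \<Rightarrow> 'a cdual" is "\<lambda>f g x. f x + g x"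
  by (auto simp: linear_iff algebra_simps intro!: continuous_intros)

lift_definition uminus_cdual :: "'a cdual \<Rightarrow> 'a cdual" is "\<lambda>f x. - f x"
  by (auto simp: linear_iff algebra_simps intro!: continuous_intros)

lift_definition minus_cdual :: "'a cdual \<Rightarrow> 'a cdual \<Rightarrow> 'a cdual" is "\<lambda>f g x. f x - g x"
  by (auto simp: linear_iff algebra_simps intro!: continuous_intros)

lift_definition scaleR_cdual :: "real \<Rightarrow> 'a cdual \<Rightarrow> 'a cdual" is "\<lambda>r f x. r * f x"
  by (auto simp: linear_iff algebra_simps intro!: continuous_intros)

instance
  by standard (transfer; auto simp: algebra_simps)+

end

definition weak_star_topology :: "'a::{real_vector, topological_space} cdual topology" where
  "weak_star_topology =
     pullback_topology UNIV cdual_apply (product_topology (\<lambda>_. euclideanreal) UNIV)"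

definition dual_pair_compatible ::
    "'a::{real_vector, topological_space} cdual topology \<Rightarrow> bool" where
  "dual_pair_compatible T \<longleftrightarrow>
     (\<forall>\<phi>. linear \<phi> \<and> continuous_map T euclideanreal \<phi> \<longleftrightarrow> (\<exists>x. \<phi> = (\<lambda>f. cdual_apply f x)))"

section \<open>Cones\<close>

definition pointed :: "'v::real_vector set \<Rightarrow> bool" where
  "pointed P \<longleftrightarrow> P \<inter> uminus ` P = {0}"

definition dual_cone :: "'a::{real_vector, topological_space} set \<Rightarrow> 'a cdual set" where
  "dual_cone K = {f. \<forall>k\<in>K. 0 \<le> cdual_apply f k}"

definition weak_property_pi :: "'v::real_vector topology \<Rightarrow> 'v set \<Rightarrow> bool" where
  "weak_property_pi T P \<longleftrightarrow>
     (\<exists>\<phi>. linear \<phi> \<and> continuous_map T euclideanreal \<phi> \<and> (\<forall>p\<in>P. 0 \<le> \<phi> p) \<and>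
        (\<exists>\<alpha>>0. tvs_bounded T (P \<inter> {p. \<phi> p \<le> \<alpha>})))"

definition bPC :: "'v::real_vector topology \<Rightarrow> 'v topology \<Rightarrow> 'v set \<Rightarrow> 'v set" where
  "bPC S T C = {x \<in> C. \<exists>W. x \<in> S interior_of W \<and> tvs_bounded T (C \<inter> W)}"

section \<open>Nets\<close>

definition directed_set :: "'i set \<Rightarrow> ('i \<Rightarrow> 'i \<Rightarrow> bool) \<Rightarrow> bool" where
  "directed_set D le \<longleftrightarrow>
     D \<noteq> {} \<and> (\<forall>a\<in>D. le a a) \<and>
     (\<forall>a\<in>D. \<forall>b\<in>D. \<forall>c\<in>D. le a b \<longrightarrow> le b c \<longrightarrow> le a c) \<and>
     (\<forall>a\<in>D. \<forall>b\<in>D. \<exists>c\<in>D. le a c \<and> le b c)"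

definition net_filter :: "'i set \<Rightarrow> ('i \<Rightarrow> 'i \<Rightarrow> bool) \<Rightarrow> 'i filter" where
  "net_filter D le = (INF d\<in>D. principal {e \<in> D. le d e})"

lemma eventually_net_filter:
  assumes "directed_set D le"
  shows "eventually P (net_filter D le) \<longleftrightarrow> (\<exists>d\<in>D. \<forall>e\<in>D. le d e \<longrightarrow> P e)"
proof -
  have "eventually P (net_filter D le) \<longleftrightarrow>
      (\<exists>d\<in>D. eventually P (principal {e \<in> D. le d e}))"
    unfolding net_filter_def
  proof (rule eventually_INF_base)
    show "D \<noteq> {}" using assms by (auto simp: directed_set_def)
  next
    fix a b assume "a \<in> D" "b \<in> D"
    with assms obtain c where c: "c \<in> D" "le a c" "le b c"
      unfolding directed_set_def by metis
    have "le x e" if "x \<in> D" "le x c" "e \<in> D" "le c e" for x e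
      using assms c that unfolding directed_set_def by metis
    with c \<open>a \<in> D\<close> \<open>b \<in> D\<close> show "\<exists>x\<in>D. principal {e \<in> D. le x e} \<le>
        inf (principal {e \<in> D. le a e}) (principal {e \<in> D. le b e})"
      by (intro bexI[of _ c]) auto
  qed
  then show ?thesis by (auto simp: eventually_principal)
qed

text \<open>\<open>S\<close> is the topology of the conclusion, \<open>T\<close> that of the hypothesis. HOL cannot quantify over
  index types inside a formula; nets indexed by directed subsets of \<^typ>\<open>'v set\<close> suffice, as
  \<open>s_ext_nets\<close> below shows that the property extends to nets with an arbitrary index type.\<close>

definition s_ext :: "'v::real_vector topology \<Rightarrow> 'v topology \<Rightarrow> 'v set \<Rightarrow> 'v set" where
  "s_ext S T C = {x \<in> C. \<forall>(D :: 'v set set) le c c'.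
     directed_set D le \<longrightarrow> (\<forall>d\<in>D. c d \<in> C \<and> c' d \<in> C) \<longrightarrow>
     limitin T (\<lambda>d. (1/2) *\<^sub>R (c d + c' d)) x (net_filter D le) \<longrightarrow>
     limitin S c x (net_filter D le)}"

lemma s_ext_nets:
  fixes D :: "'i set" and C :: "'v::real_vector set"
  assumes x: "x \<in> s_ext S T C" and D: "directed_set D le"
    and C: "\<forall>d\<in>D. c d \<in> C \<and> c' d \<in> C"
    and lim: "limitin T (\<lambda>d. (1/2) *\<^sub>R (c d + c' d)) x (net_filter D le)"
  shows "limitin S c x (net_filter D le)"
proof -
  have nets: "limitin S b x (net_filter N r)"
    if "directed_set N r" "\<forall>d\<in>N. b d \<in> C \<and> b' d \<in> C"
      "limitin T (\<lambda>d. (1/2) *\<^sub>R (b d + b' d)) x (net_filter N r)"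
    for N :: "'v set set" and r b b'
    using x that unfolding s_ext_def by blast
  have xC: "x \<in> C" using x by (simp add: s_ext_def)
  have xT: "x \<in> topspace T" using lim by (simp add: limitin_def)
  have half: "(1/2) *\<^sub>R (x + x) = x" by (simp add: scaleR_2[symmetric])
  have "limitin S (\<lambda>_. x) x (net_filter {{} :: 'v set} (\<lambda>_ _. True))"
  proof (rule nets)
    show "directed_set {{} :: 'v set} (\<lambda>_ _. True)" by (simp add: directed_set_def)
    show "\<forall>d\<in>{{} :: 'v set}. x \<in> C \<and> x \<in> C" using xC by simp
    show "limitin T (\<lambda>_. (1/2) *\<^sub>R (x + x)) x (net_filter {{} :: 'v set} (\<lambda>_ _. True))"
      unfolding half using xT by (simp add: limitin_def)
  qed
  then have xS: "x \<in> topspace S" by (simp add: limitin_def)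
  show ?thesis
    unfolding limitin_def
  proof (intro conjI allI impI xS)
    fix U assume U: "openin S U \<and> x \<in> U"
    show "eventually (\<lambda>d. c d \<in> U) (net_filter D le)"
    proof (rule ccontr)
      assume neg: "\<not> eventually (\<lambda>d. c d \<in> U) (net_filter D le)"
      define N where "N = {V. openin T V \<and> x \<in> V}"
      define r where "r = (\<lambda>V W. (W::'v set) \<subseteq> V)"
      have "\<exists>d\<in>D. c d \<notin> U \<and> (1/2) *\<^sub>R (c d + c' d) \<in> V" if "V \<in> N" for V
      proof -
        have "eventually (\<lambda>d. (1/2) *\<^sub>R (c d + c' d) \<in> V) (net_filter D le)"
          using lim that by (simp add: limitin_def N_def)
        then show ?thesis
          using neg unfolding eventually_net_filter[OF D] by meson
      qed
      then obtain g where g: "\<And>V. V \<in> N \<Longrightarrow>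
          g V \<in> D \<and> c (g V) \<notin> U \<and> (1/2) *\<^sub>R (c (g V) + c' (g V)) \<in> V"
        by metis
      have N: "directed_set N r"
        unfolding directed_set_def
      proof (intro conjI ballI)
        show "N \<noteq> {}" using xT by (auto simp: N_def)
        show "\<exists>c\<in>N. r a c \<and> r b c" if "a \<in> N" "b \<in> N" for a b
          using that by (intro bexI[of _ "a \<inter> b"]) (auto simp: N_def r_def)
      qed (auto simp: r_def)
      have "limitin S (\<lambda>V. c (g V)) x (net_filter N r)"
      proof (rule nets[OF N, of _ "\<lambda>V. c' (g V)"])
        show "\<forall>V\<in>N. c (g V) \<in> C \<and> c' (g V) \<in> C" using g C by blast
        show "limitin T (\<lambda>V. (1/2) *\<^sub>R (c (g V) + c' (g V))) x (net_filter N r)"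
          unfolding limitin_def
        proof (intro conjI allI impI xT)
          fix V assume "openin T V \<and> x \<in> V"
          then have V: "V \<in> N" by (simp add: N_def)
          show "eventually (\<lambda>W. (1/2) *\<^sub>R (c (g W) + c' (g W)) \<in> V) (net_filter N r)"
            unfolding eventually_net_filter[OF N]
            by (intro bexI[OF _ V] ballI impI) (use g in \<open>auto simp: r_def\<close>)
        qed
      qed
      then have "eventually (\<lambda>V. c (g V) \<in> U) (net_filter N r)"
        using U by (simp add: limitin_def)
      then obtain V where "V \<in> N" "\<forall>W\<in>N. r V W \<longrightarrow> c (g W) \<in> U"
        unfolding eventually_net_filter[OF N] by blast
      then show False using g[of V] by (auto simp: r_def)
    qed
  qed
qed

end

theory Submission
  imports Defs
begin

text \<open>If \<open>x \<ge> 0\<close> on the dual cone \<open>P\<close> and \<open>P \<inter> {x \<le> \<alpha>}\<close> is bounded, then by homogeneity every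
  evaluation is dominated on \<open>P\<close> by a multiple of \<open>x\<close>; this forces \<open>0\<close> to be strongly extreme, and
  then \<open>P\<close> to be pointed. Pointedness gives density of \<open>span K\<close> by Hahn-Banach. Conversely, let
  \<open>P \<inter> W\<close> be bounded, where \<open>W\<close> is the weak-star neighbourhood given by points \<open>y\<^sub>j\<close>. As \<open>E\<close> is
  barreled, \<open>P \<inter> W\<close> is equicontinuous, so each \<open>y\<^sub>j\<close> can be replaced, uniformly on \<open>P \<inter> W\<close>, by some
  \<open>z\<^sub>j \<in> span K\<close>. On \<open>P\<close> each \<open>\<bar>z\<^sub>j\<bar>\<close> is dominated by some \<open>k\<^sub>j \<in> K\<close>, and a scaling argument
  shows that a slice of \<open>P\<close> by the single point \<open>\<Sum>k\<^sub>j\<close> lies in \<open>W\<close>.\<close>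

section \<open>Sublinear functionals and Hahn-Banach\<close>

definition sublinear :: "('v::real_vector \<Rightarrow> real) \<Rightarrow> bool" where
  "sublinear q \<longleftrightarrow> (\<forall>x y. q (x + y) \<le> q x + q y) \<and> (\<forall>r\<ge>0. \<forall>x. q (r *\<^sub>R x) = r * q x)"

lemma sublinear_add: "sublinear q \<Longrightarrow> q (x + y) \<le> q x + q y"
  by (simp add: sublinear_def)

lemma sublinear_scaleR: "sublinear q \<Longrightarrow> 0 \<le> r \<Longrightarrow> q (r *\<^sub>R x) = r * q x"
  by (simp add: sublinear_def)

lemma sublinear_zero: "sublinear q \<Longrightarrow> q 0 = 0"
  using sublinear_scaleR[of q 0 0] by simp

lemma sublinear_minus: "sublinear q \<Longrightarrow> - q (- x) \<le> q x"
  using sublinear_add[of q x "- x"] sublinear_zero[of q] by simp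

text \<open>The one-sided scaling estimate suffices: using it with factor \<open>1 / r\<close> at
  \<open>r *\<^sub>R x\<close> gives the reverse inequality.\<close>

lemma sublinearI:
  assumes add: "\<And>x y. q (x + y) \<le> q x + q y" and zero: "q 0 = 0"
    and scale: "\<And>r x. 0 < r \<Longrightarrow> q (r *\<^sub>R x) \<le> r * q x"
  shows "sublinear q"
  unfolding sublinear_def
proof (intro conjI allI impI add)
  fix r :: real and x
  assume r: "0 \<le> r"
  show "q (r *\<^sub>R x) = r * q x"
  proof (cases "r = 0")
    case False
    then have "q ((1 / r) *\<^sub>R (r *\<^sub>R x)) \<le> (1 / r) * q (r *\<^sub>R x)"
      using r by (intro scale) simp
    with False r have "r * q x \<le> q (r *\<^sub>R x)"
      by (simp add: field_simps)
    with scale[of r x] False r show ?thesis by simp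
  qed (simp add: zero)
qed

text \<open>The witness is \<open>p x = inf {q (x + t y) - t q y | t \<ge> 0}\<close>. Its value at
  \<open>- y\<close> is so small that a linear functional below \<open>p\<close> is forced up to
  \<open>q y\<close> at \<open>y\<close>.\<close>

lemma sublinear_shift:
  assumes q: "sublinear q"
  obtains p where "sublinear p" "\<And>x. p x \<le> q x" "p (- y) \<le> - q y"
proof -
  define g where "g = (\<lambda>x t. q (x + t *\<^sub>R y) - t * q y)"
  define p where "p = (\<lambda>x. INF t\<in>{0..}. g x t)"
  \<comment> \<open>Subadditivity for \<open>t y = (x + t y) + (- x)\<close> gives a bound
    independent of \<open>t\<close>, so the infimum is finite.\<close>
  have lower: "- q (- x) \<le> g x t" if "t \<in> {0..}" for x t
  proof -
    have "t * q y \<le> q (x + t *\<^sub>R y) + q (- x)"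
      using sublinear_add[OF q, of "x + t *\<^sub>R y" "- x"] sublinear_scaleR[OF q, of t y] that
      by simp
    then show ?thesis by (simp add: g_def)
  qed
  have p_le: "p x \<le> g x t" if "0 \<le> t" for x t
    unfolding p_def using that lower by (intro cINF_lower bdd_belowI2) auto
  have le_p: "z \<le> p x" if "\<And>t. 0 \<le> t \<Longrightarrow> z \<le> g x t" for x z
    unfolding p_def using that by (intro cINF_greatest) auto
  have le: "p x \<le> q x" for x
    using p_le[of 0 x] by (simp add: g_def)
  have "sublinear p"
  proof (rule sublinearI)
    fix x z
    \<comment> \<open>Parameters \<open>t\<close> for \<open>x\<close> and \<open>s\<close> for
      \<open>z\<close> combine to \<open>t + s\<close> for \<open>x + z\<close>; the infima over
      \<open>t\<close> and \<open>s\<close> are then taken one after the other.\<close>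
    have "p (x + z) - g z s \<le> g x t" if "0 \<le> s" "0 \<le> t" for s t
      using p_le[of "t + s" "x + z"] that
        sublinear_add[OF q, of "x + t *\<^sub>R y" "z + s *\<^sub>R y"]
      by (simp add: g_def algebra_simps)
    then have "p (x + z) - p x \<le> g z s" if "0 \<le> s" for s
      using le_p[of "p (x + z) - g z s" x] that by fastforce
    then show "p (x + z) \<le> p x + p z"
      using le_p[of "p (x + z) - p x" z] by fastforce
  next
    show "p 0 = 0"
      using le[of 0] le_p[of 0 0] lower[of _ 0] sublinear_zero[OF q] by fastforce
  next
    fix r :: real and x
    assume r: "0 < r"
    have "p (r *\<^sub>R x) / r \<le> g x t" if "0 \<le> t" for t
    proof -
      have "p (r *\<^sub>R x) \<le> g (r *\<^sub>R x) (r * t)"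
        using r that by (intro p_le) simp
      also have "\<dots> = r * g x t"
        using sublinear_scaleR[OF q, of r "x + t *\<^sub>R y"] r by (simp add: g_def algebra_simps)
      finally show ?thesis using r by (simp add: field_simps)
    qed
    then show "p (r *\<^sub>R x) \<le> r * p x"
      using le_p[of "p (r *\<^sub>R x) / r" x] r by (simp add: field_simps)
  qed
  moreover have "p (- y) \<le> - q y"
    using p_le[of 1 "- y"] sublinear_zero[OF q] by (simp add: g_def)
  ultimately show ?thesis using that le by blast
qed

text \<open>A minimal sublinear functional is additive, because by minimality it agrees with all of its
  shifts.\<close>

lemma linear_below_sublinear:
  assumes q: "sublinear q"
  obtains f where "linear f" "\<And>x. f x \<le> q x"
proof -
  define A where "A = {p. sublinear p \<and> p \<le> q}"
  \<comment> \<open>The order is reversed, so that the maximal element provided by Zorn's lemma is a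
    minimal sublinear functional.\<close>
  define R where "R = (\<lambda>p p' :: 'a \<Rightarrow> real. p' \<le> p)"
  have "\<exists>m\<in>A. \<forall>p\<in>A. R m p \<longrightarrow> p = m"
  proof (rule predicate_Zorn)
    show "partial_order_on A (relation_of R A)"
      by (rule partial_order_on_relation_ofI) (auto simp: R_def)
  next
    fix C assume C: "C \<in> Chains (relation_of R A)"
    show "\<exists>u\<in>A. \<forall>p\<in>C. R p u"
    proof (cases "C = {}")
      case True
      then show ?thesis using q by (auto simp: A_def)
    next
      case False
      have CA: "p \<in> A" if "p \<in> C" for p
        using C that by (auto simp: Chains_def relation_of_def)
      have chain: "p \<le> p' \<or> p' \<le> p" if "p \<in> C" "p' \<in> C" for p p'
        using C that by (auto simp: Chains_def relation_of_def R_def)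
      define u where "u = (\<lambda>x. INF p\<in>C. p x)"
      have lower: "- q (- x) \<le> p x" if "p \<in> C" for p x
      proof -
        have "sublinear p" "p (- x) \<le> q (- x)"
          using CA[OF that] by (auto simp: A_def le_fun_def)
        then show ?thesis using sublinear_minus[of p x] by linarith
      qed
      have u_le: "u x \<le> p x" if "p \<in> C" for p x
        unfolding u_def using that lower by (intro cINF_lower bdd_belowI2) auto
      have le_u: "z \<le> u x" if "\<And>p. p \<in> C \<Longrightarrow> z \<le> p x" for x z
        unfolding u_def using that False by (intro cINF_greatest) auto
      have "sublinear u"
      proof (rule sublinearI)
        fix x y
        \<comment> \<open>The smaller of two comparable chain members bounds
          \<open>u (x + y)\<close> and is itself subadditive, so it handles \<open>p\<close> and
          \<open>p'\<close> at once.\<close>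
        have "u (x + y) - p' y \<le> p x" if p: "p \<in> C" "p' \<in> C" for p p'
        proof -
          obtain p'' where "p'' \<in> C" "p'' \<le> p" "p'' \<le> p'"
            using chain[OF p] p by auto
          then show ?thesis
            using u_le[of p'' "x + y"] CA[of p''] sublinear_add[of p'' x y]
            by (fastforce simp: A_def le_fun_def dest: spec[of _ x] spec[of _ y])
        qed
        then have "u (x + y) - u x \<le> p' y" if "p' \<in> C" for p'
          using le_u[of "u (x + y) - p' y" x] that by fastforce
        then show "u (x + y) \<le> u x + u y"
          using le_u[of "u (x + y) - u x" y] by fastforce
      next
        have "p 0 = 0" if "p \<in> C" for p
          using CA[OF that] sublinear_zero by (auto simp: A_def)
        then show "u 0 = 0"
          using False u_le[of _ 0] le_u[of 0 0] by fastforce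
      next
        fix r :: real and x
        assume r: "0 < r"
        have "u (r *\<^sub>R x) / r \<le> p x" if "p \<in> C" for p
          using u_le[OF that, of "r *\<^sub>R x"] CA[OF that] sublinear_scaleR[of p r x] r
          by (simp add: A_def field_simps)
        then show "u (r *\<^sub>R x) \<le> r * u x"
          using le_u[of "u (r *\<^sub>R x) / r" x] r by (simp add: field_simps)
      qed
      moreover have "u \<le> q"
      proof (rule le_funI)
        fix x
        obtain p where "p \<in> C" using False by blast
        then show "u x \<le> q x"
          using u_le[of p x] CA[of p] by (auto simp: A_def le_fun_def intro: order_trans)
      qed
      ultimately show ?thesis
        using u_le by (intro bexI[of _ u]) (auto simp: A_def R_def le_fun_def)
    qed
  qed
  then obtain m where m: "sublinear m" "m \<le> q"
    and minimal: "\<And>p. sublinear p \<Longrightarrow> p \<le> m \<Longrightarrow> p = m"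
    by (auto simp: A_def R_def intro: order_trans)
  have neg: "m (- y) = - m y" for y
  proof -
    obtain p where p: "sublinear p" "\<And>x. p x \<le> m x" "p (- y) \<le> - m y"
      using sublinear_shift[OF m(1)] by blast
    then have "p = m" by (intro minimal le_funI)
    then show ?thesis using p(3) sublinear_minus[OF m(1), of y] by simp
  qed
  \<comment> \<open>Oddness gives the missing direction:
    \<open>m x \<le> m (x + y) + m (- y)\<close>.\<close>
  have add: "m (x + y) = m x + m y" for x y
    using sublinear_add[OF m(1), of "x + y" "- y"] sublinear_add[OF m(1), of x y] neg[of y]
    by simp
  have "linear m"
  proof (rule linearI)
    fix r :: real and x
    show "m (r *\<^sub>R x) = r *\<^sub>R m x"
    proof (cases "0 \<le> r")
      case True
      then show ?thesis by (simp add: sublinear_scaleR[OF m(1)])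
    next
      case False
      then show ?thesis
        using neg[of "r *\<^sub>R x"] sublinear_scaleR[OF m(1), of "- r" x] by simp
    qed
  qed (rule add)
  then show ?thesis using that m(2) by (auto simp: le_fun_def)
qed

lemma Hahn_Banach_sublinear:
  assumes "sublinear q"
  obtains f where "linear f" "\<And>x. f x \<le> q x" "f y = q y"
proof -
  obtain p where p: "sublinear p" "\<And>x. p x \<le> q x" "p (- y) \<le> - q y"
    using sublinear_shift[OF assms] by blast
  obtain f where f: "linear f" "\<And>x. f x \<le> p x"
    using linear_below_sublinear[OF p(1)] by blast
  have "f y = q y"
    using f(2)[of y] f(2)[of "- y"] p(2)[of y] p(3) linear_neg[OF f(1), of y] by simp
  then show ?thesis using that f p(2) order_trans by blast
qed

section \<open>Separation from a convex cone\<close>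

lemma interior_of_euclidean: "euclidean interior_of S = interior S"
  by (auto simp: interior_of_def interior_def)

text \<open>The sort of \<open>'a\<close> does not link its topology to its vector operations; their
  continuity is extracted from \<open>locally_convex_topology\<close> by composing with a
  pair.\<close>

lemma continuous_on_add_lc:
  fixes f g :: "'b::topological_space \<Rightarrow> 'a::{real_vector, topological_space}"
  assumes "locally_convex_topology (euclidean :: 'a topology)"
    and "continuous_on S f" "continuous_on S g"
  shows "continuous_on S (\<lambda>x. f x + g x)"
proof -
  have "continuous_on UNIV (\<lambda>(x, y). x + y :: 'a)"
    using assms(1) by (simp add: locally_convex_topology_def euclidean_product_topology)
  from continuous_on_compose2[OF this continuous_on_Pair[OF assms(2,3)]] show ?thesis by simp
qed

lemma continuous_on_scaleR_lc:
  fixes f :: "'b::topological_space \<Rightarrow> 'a::{real_vector, topological_space}"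
  assumes "locally_convex_topology (euclidean :: 'a topology)"
    and "continuous_on S r" "continuous_on S f"
  shows "continuous_on S (\<lambda>x. r x *\<^sub>R f x)"
proof -
  have "continuous_on UNIV (\<lambda>(r, x :: 'a). r *\<^sub>R x)"
    using assms(1) by (simp add: locally_convex_topology_def euclidean_product_topology)
  from continuous_on_compose2[OF this continuous_on_Pair[OF assms(2,3)]] show ?thesis by simp
qed

text \<open>The map \<open>x \<mapsto> r (x - y)\<close> is continuous and sends \<open>y\<close> to
  \<open>0\<close>. This serves both for continuity of functionals and for approximation by points
  of a dense set.\<close>

lemma eventually_affine_nhds:
  fixes y :: "'a::{real_vector, topological_space}"
  assumes lc: "locally_convex_topology (euclidean :: 'a topology)"
    and V: "0 \<in> interior V"
  shows "\<forall>\<^sub>F x in nhds y. r *\<^sub>R (x - y) \<in> V"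
proof -
  have "continuous_on UNIV (\<lambda>x. r *\<^sub>R (x + - y))"
    by (intro continuous_on_scaleR_lc[OF lc] continuous_on_add_lc[OF lc] continuous_intros)
  then have "open ((\<lambda>x. r *\<^sub>R (x - y)) -` interior V)"
    using open_vimage[OF open_interior] by simp
  moreover have "y \<in> (\<lambda>x. r *\<^sub>R (x - y)) -` interior V" using V by simp
  ultimately show ?thesis
    by (rule eventually_mono[OF eventually_nhds_in_open]) (use interior_subset in auto)
qed

lemma linear_bounded_above_imp_continuous:
  fixes f :: "'a::{real_vector, topological_space} \<Rightarrow> real"
  assumes lc: "locally_convex_topology (euclidean :: 'a topology)"
    and f: "linear f" and V: "0 \<in> interior V" and le: "\<And>x. x \<in> V \<Longrightarrow> f x \<le> 1"
  shows "continuous_on UNIV f"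
proof -
  have "(f \<longlongrightarrow> f y) (nhds y)" for y
  proof (rule order_tendstoI)
    fix a assume a: "f y < a"
    \<comment> \<open>With this factor the bound by 1 says
      \<open>f x - f y \<le> (a - f y) / 2\<close>, which is strictly below \<open>a - f y\<close>.
      A negative factor later gives the lower estimate from the same one-sided bound.\<close>
    have "\<forall>\<^sub>F x in nhds y. (2 / (a - f y)) *\<^sub>R (x - y) \<in> V"
      by (rule eventually_affine_nhds[OF lc V])
    then show "\<forall>\<^sub>F x in nhds y. f x < a"
    proof eventually_elim
      case (elim x)
      from le[OF elim] have "(2 / (a - f y)) * (f x - f y) \<le> 1"
        by (simp add: linear_cmul[OF f] linear_diff[OF f])
      then show ?case using a by (simp add: field_simps)
    qed
  next
    fix a assume a: "a < f y"
    have "\<forall>\<^sub>F x in nhds y. (- 2 / (f y - a)) *\<^sub>R (x - y) \<in> V"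
      by (rule eventually_affine_nhds[OF lc V])
    then show "\<forall>\<^sub>F x in nhds y. a < f x"
    proof eventually_elim
      case (elim x)
      from le[OF elim] have "(- 2 / (f y - a)) * (f x - f y) \<le> 1"
        by (simp only: linear_cmul[OF f] linear_diff[OF f] real_scaleR_def)
      then show ?case using a by (simp add: field_simps)
    qed
  qed
  then show ?thesis
    by (auto simp: continuous_on_def intro: tendsto_mono[OF at_within_le_nhds])
qed

text \<open>Separation by Hahn-Banach: if \<open>x + V\<close> misses \<open>K\<close>, the
  Minkowski functional \<open>q\<close> of \<open>V - K\<close> is at most 1 on \<open>V\<close>, at
  most 0 on \<open>- K\<close>, and at least 1 at \<open>- x\<close>. A linear functional below
  \<open>q\<close> that agrees with it at \<open>- x\<close> is continuous, nonnegative on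
  \<open>K\<close> and negative at \<open>x\<close>.\<close>

lemma in_closure_convex_cone:
  fixes K :: "'a::{real_vector, topological_space} set"
  assumes lc: "locally_convex_topology (euclidean :: 'a topology)"
    and K: "convex_cone K" and nonneg: "\<And>f. f \<in> dual_cone K \<Longrightarrow> 0 \<le> cdual_apply f x"
  shows "x \<in> closure K"
proof (rule ccontr)
  assume x: "x \<notin> closure K"
  have K0: "0 \<in> K" and Kadd: "\<And>k l. k \<in> K \<Longrightarrow> l \<in> K \<Longrightarrow> k + l \<in> K"
    and Kscale: "\<And>r k. 0 \<le> r \<Longrightarrow> k \<in> K \<Longrightarrow> r *\<^sub>R k \<in> K"
    using K by (auto simp: convex_cone_contains_0 convex_cone_add convex_cone_scaleR)
  have "continuous_on UNIV (\<lambda>v. x + v)"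
    by (intro continuous_on_add_lc[OF lc] continuous_intros)
  then have "open ((\<lambda>v. x + v) -` (- closure K))"
    by (intro open_vimage) auto
  then have "0 \<in> interior ((\<lambda>v. x + v) -` (- closure K))"
    using x by (simp add: interior_open)
  then obtain V where V: "V \<subseteq> (\<lambda>v. x + v) -` (- closure K)" "convex V" "0 \<in> interior V"
    using lc unfolding locally_convex_topology_def by (metis interior_of_euclidean)
  have V0: "0 \<in> V" using V(3) interior_subset by blast
  have disj: "x + v \<notin> K" if "v \<in> V" for v
    using V(1) that closure_subset[of K] by blast
  \<comment> \<open>Small multiples of \<open>y\<close> enter \<open>V\<close> by continuity of
    scaling, so the sets \<open>S y\<close> below are nonempty.\<close>
  have absorb: "\<exists>t>0. \<exists>v\<in>V. y = t *\<^sub>R v" for y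
  proof -
    have "continuous_on UNIV (\<lambda>t :: real. t *\<^sub>R y)"
      by (intro continuous_on_scaleR_lc[OF lc] continuous_intros)
    then have "open ((\<lambda>t :: real. t *\<^sub>R y) -` interior V)"
      by (intro open_vimage) auto
    moreover have "0 \<in> (\<lambda>t :: real. t *\<^sub>R y) -` interior V" using V(3) by simp
    ultimately obtain e where "e > 0" "ball 0 e \<subseteq> (\<lambda>t :: real. t *\<^sub>R y) -` interior V"
      by (meson open_contains_ball)
    then have "(e / 2) *\<^sub>R y \<in> V" using interior_subset[of V] by (force simp: subset_iff)
    then show ?thesis using \<open>e > 0\<close> by (intro exI[of _ "2 / e"]) force
  qed
  \<comment> \<open>\<open>S y\<close> collects the \<open>t \<ge> 0\<close> with
    \<open>y \<in> t V - K\<close>.\<close>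
  define S where "S = (\<lambda>y. {t. 0 \<le> t \<and> (\<exists>k\<in>K. \<exists>v\<in>V. y + k = t *\<^sub>R v)})"
  define q where "q = (\<lambda>y. Inf (S y))"
  have ne: "S y \<noteq> {}" for y
  proof -
    obtain t v where "0 < t" "v \<in> V" "y = t *\<^sub>R v" using absorb by blast
    then have "t \<in> S y" using K0 unfolding S_def by force
    then show ?thesis by blast
  qed
  have bdd: "bdd_below (S y)" for y
    unfolding S_def by (rule bdd_belowI[of _ 0]) auto
  have q_le: "q y \<le> t" if "t \<in> S y" for y t
    unfolding q_def using that bdd by (rule cInf_lower)
  have le_q: "z \<le> q y" if "\<And>t. t \<in> S y \<Longrightarrow> z \<le> t" for y z
    unfolding q_def using that ne by (intro cInf_greatest) auto
  have q_neg: "q (- k) \<le> 0" if "k \<in> K" for k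
    using that V0 by (intro q_le) (force simp: S_def)
  have q_V: "q v \<le> 1" if "v \<in> V" for v
    using that K0 by (intro q_le) (force simp: S_def)
  have "sublinear q"
  proof (rule sublinearI)
    fix y z
    have S_add: "s + t \<in> S (y + z)" if st: "s \<in> S y" "t \<in> S z" for s t
    proof -
      obtain k v l w where *: "0 \<le> s" "0 \<le> t" "k \<in> K" "l \<in> K" "v \<in> V" "w \<in> V"
        "y + k = s *\<^sub>R v" "z + l = t *\<^sub>R w"
        using st unfolding S_def by blast
      \<comment> \<open>Convexity gives \<open>s V + t V \<subseteq> (s + t) V\<close>; the division
        by \<open>s + t\<close> requires treating \<open>s = t = 0\<close> apart.\<close>
      have "\<exists>u\<in>V. s *\<^sub>R v + t *\<^sub>R w = (s + t) *\<^sub>R u"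
      proof (cases "s + t = 0")
        case True
        then have "s = 0" "t = 0" using *(1,2) by linarith+
        then show ?thesis using V0 by auto
      next
        case False
        then have "(s / (s + t)) *\<^sub>R v + (t / (s + t)) *\<^sub>R w \<in> V"
          using * by (intro convexD[OF V(2)]) (auto simp flip: add_divide_distrib)
        then show ?thesis using False
          by (intro bexI) (auto simp: scaleR_add_right)
      qed
      moreover have "(y + z) + (k + l) = s *\<^sub>R v + t *\<^sub>R w"
        using * by (simp add: algebra_simps flip: *(7,8))
      ultimately show ?thesis
        using * Kadd unfolding S_def by force
    qed
    have "q (y + z) - t \<le> q y" if "t \<in> S z" for t
    proof (rule le_q)
      fix s assume "s \<in> S y"
      then show "q (y + z) - t \<le> s" using q_le[OF S_add[OF _ that]] by fastforce
    qed
    then show "q (y + z) \<le> q y + q z"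
      using le_q[of z "q (y + z) - q y"] by fastforce
  next
    show "q 0 = 0"
      using q_neg[OF K0] le_q[of 0 0] by (force simp: S_def)
  next
    fix r :: real and y
    assume r: "0 < r"
    have "q (r *\<^sub>R y) / r \<le> t" if "t \<in> S y" for t
    proof -
      obtain k v where "0 \<le> t" "k \<in> K" "v \<in> V" "y + k = t *\<^sub>R v"
        using \<open>t \<in> S y\<close> unfolding S_def by blast
      moreover from this have "r *\<^sub>R y + r *\<^sub>R k = (r * t) *\<^sub>R v"
        by (metis scaleR_add_right scaleR_scaleR)
      ultimately have "r * t \<in> S (r *\<^sub>R y)"
        using r Kscale[of r k] unfolding S_def by (auto intro!: bexI)
      then show ?thesis using q_le r by (force simp: field_simps)
    qed
    then show "q (r *\<^sub>R y) \<le> r * q y"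
      using le_q[of y "q (r *\<^sub>R y) / r"] r by (simp add: field_simps)
  qed
  then obtain f where f: "linear f" "\<And>y. f y \<le> q y" "f (- x) = q (- x)"
    using Hahn_Banach_sublinear by blast
  \<comment> \<open>For \<open>t < 1\<close> the point \<open>t v\<close> lies in \<open>V\<close>
    by convexity, and \<open>- x + k = t v\<close> would put \<open>x + t v = k\<close> in
    \<open>K\<close>.\<close>
  have "1 \<le> q (- x)"
  proof (rule le_q, rule ccontr)
    fix t assume "t \<in> S (- x)" "\<not> 1 \<le> t"
    then obtain k v where *: "0 \<le> t" "t \<le> 1" "k \<in> K" "v \<in> V" "- x + k = t *\<^sub>R v"
      unfolding S_def by force
    have "t *\<^sub>R v + (1 - t) *\<^sub>R 0 \<in> V"
      using * V0 by (intro convexD[OF V(2)]) auto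
    then show False using disj * by (metis add.right_neutral add_minus_cancel scaleR_zero_right)
  qed
  then have fx: "f x < 0" using f(3) linear_neg[OF f(1), of x] by simp
  have "continuous_on UNIV f"
    using f(2) q_V by (intro linear_bounded_above_imp_continuous[OF lc f(1) V(3)]) (rule order_trans)
  then have app: "cdual_apply (Abs_cdual f) = f"
    using f(1) by (simp add: Abs_cdual_inverse)
  have "0 \<le> f k" if "k \<in> K" for k
    using f(2)[of "- k"] q_neg[OF that] linear_neg[OF f(1), of k] by simp
  then have "Abs_cdual f \<in> dual_cone K" by (simp add: dual_cone_def app)
  from nonneg[OF this] show False using fx by (simp add: app)
qed

section \<open>Bounded slices of cones\<close>

text \<open>If \<open>\<phi> p > 0\<close>, rescale \<open>p\<close> so that \<open>\<phi>\<close>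
  takes the value \<open>\<alpha>\<close>. If \<open>\<phi> p = 0\<close>, the whole ray through
  \<open>p\<close> lies in the slice, and a functional bounded on a ray vanishes there.\<close>

lemma cone_functional_bound:
  fixes \<phi> \<psi> :: "'v::real_vector \<Rightarrow> real"
  assumes P: "conic P" and \<phi>: "linear \<phi>" "\<And>p. p \<in> P \<Longrightarrow> 0 \<le> \<phi> p" and \<psi>: "linear \<psi>"
    and \<alpha>: "0 < \<alpha>" and M: "\<And>p. p \<in> P \<Longrightarrow> \<phi> p \<le> \<alpha> \<Longrightarrow> \<bar>\<psi> p\<bar> \<le> M" and p: "p \<in> P"
  shows "\<bar>\<psi> p\<bar> \<le> M / \<alpha> * \<phi> p"
proof (cases "\<phi> p = 0")
  case True
  have "\<bar>\<psi> p\<bar> \<le> 0"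
  proof (rule ccontr)
    assume pos: "\<not> \<bar>\<psi> p\<bar> \<le> 0"
    have "0 \<le> M" using M[OF p] True \<alpha> by linarith
    \<comment> \<open>This multiple of \<open>p\<close> has \<open>\<bar>\<psi>\<bar>\<close> equal
      to \<open>M + 1\<close>, exceeding the bound.\<close>
    then have "((M + 1) / \<bar>\<psi> p\<bar>) *\<^sub>R p \<in> P"
      using P p by (auto simp: conic_def)
    then have "\<bar>\<psi> (((M + 1) / \<bar>\<psi> p\<bar>) *\<^sub>R p)\<bar> \<le> M"
      using True \<alpha> by (intro M) (auto simp: linear_cmul[OF \<phi>(1)])
    then show False using pos \<open>0 \<le> M\<close> by (simp add: linear_cmul[OF \<psi>] abs_mult)
  qed
  then show ?thesis using True by simp
next
  case False
  then have pos: "0 < \<phi> p" using \<phi>(2)[OF p] by simp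
  then have "(\<alpha> / \<phi> p) *\<^sub>R p \<in> P" using P p \<alpha> by (auto simp: conic_def)
  then have "\<bar>\<psi> ((\<alpha> / \<phi> p) *\<^sub>R p)\<bar> \<le> M"
    using pos by (intro M) (auto simp: linear_cmul[OF \<phi>(1)])
  then show ?thesis using pos \<alpha> by (simp add: linear_cmul[OF \<psi>] abs_mult field_simps)
qed

lemma tvs_bounded_subset: "tvs_bounded T B \<Longrightarrow> A \<subseteq> B \<Longrightarrow> tvs_bounded T A"
  unfolding tvs_bounded_def by (meson order_trans)

lemma tvs_bounded_imp_functional_bounded:
  assumes B: "tvs_bounded T B" and T: "0 \<in> topspace T"
    and \<phi>: "linear \<phi>" "continuous_map T euclideanreal \<phi>"
  obtains M where "\<And>f. f \<in> B \<Longrightarrow> \<bar>\<phi> f\<bar> \<le> M"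
proof -
  define U where "U = {f \<in> topspace T. \<phi> f \<in> {-1<..<1}}"
  have "openin T U"
    unfolding U_def by (rule openin_continuous_map_preimage[OF \<phi>(2)]) auto
  moreover have "0 \<in> U" using T by (simp add: U_def linear_0[OF \<phi>(1)])
  ultimately have "0 \<in> T interior_of U" by (simp add: interior_of_openin)
  then obtain t where t: "t > 0" "B \<subseteq> (\<lambda>x. t *\<^sub>R x) ` U"
    using B by (auto simp: tvs_bounded_def)
  have "\<bar>\<phi> f\<bar> \<le> t" if f: "f \<in> B" for f
  proof -
    obtain u where "u \<in> U" "f = t *\<^sub>R u" using t f by blast
    then show ?thesis
      using t(1) by (auto simp: U_def linear_cmul[OF \<phi>(1)] abs_mult intro: mult_left_le)
  qed
  then show ?thesis by (rule that)
qed

text \<open>Every continuous functional is bounded on the bounded slice, and homogeneity spreads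
  that bound over the cone as a multiple of \<open>\<phi>\<close>.\<close>

lemma weak_property_pi_dominating_functional:
  assumes pi: "weak_property_pi T P" and P: "conic P" and T: "0 \<in> topspace T"
  obtains \<phi> where "linear \<phi>" "continuous_map T euclideanreal \<phi>" "\<And>p. p \<in> P \<Longrightarrow> 0 \<le> \<phi> p"
    "\<And>\<psi>. linear \<psi> \<Longrightarrow> continuous_map T euclideanreal \<psi> \<Longrightarrow> \<exists>C. \<forall>p\<in>P. \<bar>\<psi> p\<bar> \<le> C * \<phi> p"
proof -
  from pi obtain \<phi> \<alpha> where \<phi>: "linear \<phi>" "continuous_map T euclideanreal \<phi>"
      "\<And>p. p \<in> P \<Longrightarrow> 0 \<le> \<phi> p"
    and \<alpha>: "0 < \<alpha>" and B: "tvs_bounded T (P \<inter> {p. \<phi> p \<le> \<alpha>})"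
    unfolding weak_property_pi_def by blast
  have dom: "\<exists>C. \<forall>p\<in>P. \<bar>\<psi> p\<bar> \<le> C * \<phi> p" if \<psi>: "linear \<psi>" "continuous_map T euclideanreal \<psi>" for \<psi>
  proof -
    obtain M where "\<And>p. p \<in> P \<inter> {p. \<phi> p \<le> \<alpha>} \<Longrightarrow> \<bar>\<psi> p\<bar> \<le> M"
      using tvs_bounded_imp_functional_bounded[OF B T \<psi>] by blast
    then show ?thesis
      using cone_functional_bound[OF P \<phi>(1,3) \<psi>(1) \<alpha>, of M] by blast
  qed
  show ?thesis by (rule that[OF \<phi> dom])
qed

section \<open>The weak-star topology and the dual cone\<close>

lemma linear_cdual_apply: "linear (cdual_apply f)"
  and continuous_on_cdual_apply: "continuous_on S (cdual_apply f)"
  using cdual_apply[of f] by (auto intro: continuous_on_subset)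

lemma linear_cdual_eval: "linear (\<lambda>f. cdual_apply f x)"
  by (rule linearI) (simp_all add: plus_cdual.rep_eq scaleR_cdual.rep_eq)

lemma cdual_eq_0_iff: "f = 0 \<longleftrightarrow> (\<forall>x. cdual_apply f x = 0)"
  by (auto simp: cdual_apply_inject[symmetric] zero_cdual.rep_eq)

lemma conic_dual_cone: "conic (dual_cone K)"
  by (simp add: conic_def dual_cone_def scaleR_cdual.rep_eq)

lemma zero_in_dual_cone: "0 \<in> dual_cone K"
  by (simp add: dual_cone_def zero_cdual.rep_eq)

text \<open>A basic open set of the product topology restricts only finitely many coordinates; the
  least of the radii there serves for all of them.\<close>

lemma weak_star_nhds_zero_iff:
  fixes W :: "'a::{real_vector, topological_space} cdual set"
  shows "0 \<in> weak_star_topology interior_of W \<longleftrightarrow>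
    (\<exists>F \<epsilon>. finite F \<and> 0 < \<epsilon> \<and> {f. \<forall>y\<in>F. \<bar>cdual_apply f y\<bar> < \<epsilon>} \<subseteq> W)"
proof
  assume "0 \<in> weak_star_topology interior_of W"
  then obtain V where "openin weak_star_topology V" "0 \<in> V" "V \<subseteq> W"
    by (auto simp: interior_of_def)
  then obtain U where U: "openin (product_topology (\<lambda>_. euclideanreal) UNIV) U"
      "cdual_apply (0 :: 'a cdual) \<in> U" "cdual_apply -` U \<subseteq> W"
    by (auto simp: weak_star_topology_def openin_pullback_topology)
  from U(1)[unfolded openin_product_topology_alt, rule_format, OF U(2)]
  obtain X where X: "finite {y. X y \<noteq> (UNIV :: real set)}" "\<And>y. open (X y)"
      "cdual_apply (0 :: 'a cdual) \<in> Pi\<^sub>E UNIV X" "Pi\<^sub>E UNIV X \<subseteq> U"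
    by (simp flip: open_openin) blast
  define F where "F = {y. X y \<noteq> UNIV}"
  have "\<exists>e>0. ball 0 e \<subseteq> X y" for y
  proof -
    have "0 \<in> X y" using X(3) by (auto simp: PiE_iff zero_cdual.rep_eq)
    then show ?thesis using X(2) by (meson open_contains_ball)
  qed
  then obtain e where e: "\<And>y. 0 < e y" "\<And>y. ball 0 (e y) \<subseteq> X y" by metis
  \<comment> \<open>The inserted 1 keeps the minimum defined and positive when \<open>F\<close> is
    empty.\<close>
  define \<epsilon> where "\<epsilon> = Min (insert 1 (e ` F))"
  have fin: "finite F" using X(1) by (simp add: F_def)
  have "0 < \<epsilon>" using fin e by (simp add: \<epsilon>_def)
  moreover have "f \<in> W" if f: "\<forall>y\<in>F. \<bar>cdual_apply f y\<bar> < \<epsilon>" for f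
  proof -
    have "cdual_apply f y \<in> X y" for y
    proof (cases "y \<in> F")
      case True
      then have "\<epsilon> \<le> e y" using fin by (simp add: \<epsilon>_def)
      then show ?thesis using f True e(2)[of y] by (force simp: subset_iff)
    qed (simp add: F_def)
    then have "cdual_apply f \<in> U" using X(4) by (auto simp: PiE_UNIV_domain)
    then show ?thesis using U(3) by blast
  qed
  ultimately show "\<exists>F \<epsilon>. finite F \<and> 0 < \<epsilon> \<and> {f. \<forall>y\<in>F. \<bar>cdual_apply f y\<bar> < \<epsilon>} \<subseteq> W"
    using fin by blast
next
  assume "\<exists>F \<epsilon>. finite F \<and> 0 < \<epsilon> \<and> {f. \<forall>y\<in>F. \<bar>cdual_apply f y\<bar> < \<epsilon>} \<subseteq> W"
  then obtain F \<epsilon> where F: "finite F" "0 < \<epsilon>" "{f. \<forall>y\<in>F. \<bar>cdual_apply f y\<bar> < \<epsilon>} \<subseteq> W"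
    by blast
  define V where "V = (\<lambda>y. {f :: 'a cdual. \<bar>cdual_apply f y\<bar> < \<epsilon>})"
  have top: "topspace (weak_star_topology :: 'a cdual topology) = UNIV"
    by (simp add: weak_star_topology_def topspace_pullback_topology)
  have "openin weak_star_topology (V y)" for y
  proof -
    have "continuous_map weak_star_topology euclideanreal ((\<lambda>g. g y) \<circ> cdual_apply :: 'a cdual \<Rightarrow> real)"
      unfolding weak_star_topology_def
      by (intro continuous_map_pullback continuous_map_product_projection) simp
    from openin_continuous_map_preimage[OF this, of "{- \<epsilon><..<\<epsilon>}"]
    show ?thesis by (simp add: top V_def abs_less_iff conj_commute minus_less_iff)
  qed
  then have "openin weak_star_topology (topspace weak_star_topology \<inter> (\<Inter>y\<in>F. V y))"
    by (cases "F = {}") (auto intro!: openin_Int openin_Inter F(1))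
  moreover have "topspace weak_star_topology \<inter> (\<Inter>y\<in>F. V y) \<subseteq> W"
    using F(3) by (auto simp: V_def)
  moreover have "0 \<in> topspace weak_star_topology \<inter> (\<Inter>y\<in>F. V y)"
    using F(2) by (simp add: V_def top zero_cdual.rep_eq)
  ultimately show "0 \<in> weak_star_topology interior_of W"
    by (auto simp: interior_of_def)
qed

text \<open>The absolute polar of \<open>B\<close> is always closed, convex and balanced; pointwise
  boundedness of \<open>B\<close> is what makes it absorbent, hence a barrel.\<close>

lemma barreled_imp_equicontinuous:
  fixes B :: "'a::{real_vector, topological_space} cdual set"
  assumes barreled: "barreled (euclidean :: 'a topology)"
    and bdd: "\<And>y. \<exists>M. \<forall>f\<in>B. \<bar>cdual_apply f y\<bar> \<le> M"
  shows "0 \<in> interior {y. \<forall>f\<in>B. \<bar>cdual_apply f y\<bar> \<le> 1}"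
proof -
  let ?D = "{y. \<forall>f\<in>B. \<bar>cdual_apply f y\<bar> \<le> 1}"
  have "?D = (\<Inter>f\<in>B. {y. \<bar>cdual_apply f y\<bar> \<le> 1})" by blast
  moreover have "closed (\<Inter>f\<in>B. {y. \<bar>cdual_apply f y\<bar> \<le> 1})"
    by (intro closed_INT ballI closed_Collect_le continuous_intros continuous_on_cdual_apply)
  ultimately have "closed ?D" by simp
  moreover have "convex ?D"
  proof (rule convexI)
    fix x y and u v :: real
    assume *: "x \<in> ?D" "y \<in> ?D" "0 \<le> u" "0 \<le> v" "u + v = 1"
    have "\<bar>u * cdual_apply f x + v * cdual_apply f y\<bar> \<le> 1" if "f \<in> B" for f
    proof -
      have "\<bar>u * cdual_apply f x + v * cdual_apply f y\<bar> \<le> u * \<bar>cdual_apply f x\<bar> + v * \<bar>cdual_apply f y\<bar>"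
        using * by (metis abs_mult abs_of_nonneg abs_triangle_ineq)
      also have "\<dots> \<le> 1" using * that by (intro convex_bound_le) auto
      finally show ?thesis .
    qed
    then show "u *\<^sub>R x + v *\<^sub>R y \<in> ?D"
      by (simp add: linear_add[OF linear_cdual_apply] linear_cmul[OF linear_cdual_apply])
  qed
  moreover have "balanced ?D"
    unfolding balanced_def
    by (auto simp: linear_cmul[OF linear_cdual_apply] abs_mult intro!: mult_le_one)
  moreover have "absorbent ?D"
    unfolding absorbent_def
  proof
    fix y
    obtain M where M: "\<And>f. f \<in> B \<Longrightarrow> \<bar>cdual_apply f y\<bar> \<le> M" using bdd by blast
    define N where "N = \<bar>M\<bar> + 1"
    have N: "0 < N" "M \<le> N" by (auto simp: N_def)
    have "\<bar>cdual_apply f (r *\<^sub>R y)\<bar> \<le> 1" if "\<bar>r\<bar> \<le> 1 / N" "f \<in> B" for r f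
    proof -
      have "\<bar>r\<bar> * \<bar>cdual_apply f y\<bar> \<le> (1 / N) * N"
        using that M[of f] N by (intro mult_mono) auto
      then show ?thesis using N by (simp add: linear_cmul[OF linear_cdual_apply] abs_mult)
    qed
    then show "\<exists>t>0. \<forall>r. \<bar>r\<bar> \<le> t \<longrightarrow> r *\<^sub>R y \<in> ?D"
      using N by (intro exI[of _ "1 / N"]) auto
  qed
  ultimately have "barrel euclidean ?D" by (simp add: barrel_def)
  then show ?thesis using barreled by (simp add: barreled_def interior_of_euclidean)
qed

text \<open>The dominated vectors form a subspace (\<open>k + l\<close> serves for a sum,
  \<open>\<bar>c\<bar> k\<close> for a multiple) and include \<open>K\<close>, whose elements
  dominate themselves.\<close>

lemma span_dominated_on_dual_cone:
  assumes K: "convex_cone K" and z: "z \<in> span K"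
  obtains k where "k \<in> K" "\<And>f. f \<in> dual_cone K \<Longrightarrow> \<bar>cdual_apply f z\<bar> \<le> cdual_apply f k"
proof -
  let ?dom = "\<lambda>z k. \<forall>f\<in>dual_cone K. \<bar>cdual_apply f z\<bar> \<le> cdual_apply f k"
  have "\<exists>k\<in>K. ?dom z k"
    using z
  proof (induction rule: span_induct)
    case base
    show ?case
      unfolding subspace_def
    proof (intro conjI ballI allI; unfold mem_Collect_eq)
      show "\<exists>k\<in>K. ?dom 0 k"
        using convex_cone_contains_0[OF K]
        by (intro bexI[of _ 0]) (auto simp: linear_0[OF linear_cdual_apply])
    next
      fix x y assume "\<exists>k\<in>K. ?dom x k" "\<exists>k\<in>K. ?dom y k"
      then obtain k l where "k \<in> K" "l \<in> K" "?dom x k" "?dom y l" by blast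
      then show "\<exists>k\<in>K. ?dom (x + y) k"
        by (intro bexI[of _ "k + l"])
          (auto simp: linear_add[OF linear_cdual_apply] convex_cone_add[OF K]
            intro: order_trans[OF abs_triangle_ineq add_mono])
    next
      fix c x assume "\<exists>k\<in>K. ?dom x k"
      then obtain k where "k \<in> K" "?dom x k" by blast
      then show "\<exists>k\<in>K. ?dom (c *\<^sub>R x) k"
        by (intro bexI[of _ "\<bar>c\<bar> *\<^sub>R k"])
          (auto simp: linear_cmul[OF linear_cdual_apply] abs_mult convex_cone_scaleR[OF K]
            intro: mult_left_mono)
    qed
  next
    case (step x)
    then show ?case by (intro bexI[of _ x]) (auto simp: dual_cone_def)
  qed
  then show ?thesis using that by blast
qed

text \<open>A functional nonnegative on the subspace \<open>span K\<close> vanishes on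
  \<open>K\<close>, so it and its negative lie in \<open>dual_cone K\<close>. Pointedness makes it
  0, and nothing separates a point from \<open>span K\<close>.\<close>

lemma pointed_dual_cone_imp_dense_span:
  fixes K :: "'a::{real_vector, topological_space} set"
  assumes lc: "locally_convex_topology (euclidean :: 'a topology)"
    and pointed: "pointed (dual_cone K)"
  shows "closure (span K) = UNIV"
proof -
  have "x \<in> closure (span K)" for x
  proof (rule in_closure_convex_cone[OF lc])
    show "convex_cone (span K)"
      by (simp add: convex_cone_iff span_zero span_add span_scale)
    fix f assume f: "f \<in> dual_cone (span K)"
    have "0 \<le> cdual_apply f k" "0 \<le> cdual_apply (- f) k" if "k \<in> K" for k
      using f span_base[OF that] span_neg[OF span_base[OF that]]
      by (auto simp: dual_cone_def uminus_cdual.rep_eq linear_neg[OF linear_cdual_apply])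
    then have "f \<in> dual_cone K \<inter> uminus ` dual_cone K"
      by (auto simp: dual_cone_def intro!: image_eqI[of f uminus "- f"])
    then have "f = 0" using pointed unfolding pointed_def by blast
    then show "0 \<le> cdual_apply f x" by (simp add: zero_cdual.rep_eq)
  qed
  then show ?thesis by blast
qed

lemma bounded_slice_of_dense_span:
  fixes K :: "'a::{real_vector, topological_space} set"
  assumes lc: "locally_convex_topology (euclidean :: 'a topology)"
    and barreled: "barreled (euclidean :: 'a topology)" and K: "convex_cone K"
    and T: "0 \<in> topspace T" "\<And>y. continuous_map T euclideanreal (\<lambda>f. cdual_apply f y)"
    and bPC: "0 \<in> bPC weak_star_topology T (dual_cone K)" and dense: "closure (span K) = UNIV"
  obtains x r where "x \<in> K" "0 < r" "tvs_bounded T ({f. cdual_apply f x < r} \<inter> dual_cone K)"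
proof -
  obtain W where "0 \<in> weak_star_topology interior_of W" and WB: "tvs_bounded T (dual_cone K \<inter> W)"
    using bPC by (auto simp: bPC_def)
  then obtain F \<epsilon> where F: "finite F" "0 < \<epsilon>" "{f. \<forall>y\<in>F. \<bar>cdual_apply f y\<bar> < \<epsilon>} \<subseteq> W"
    by (auto simp: weak_star_nhds_zero_iff)
  define B where "B = dual_cone K \<inter> W"
  define D where "D = {y. \<forall>f\<in>B. \<bar>cdual_apply f y\<bar> \<le> 1}"
  have D: "0 \<in> interior D"
    unfolding D_def
  proof (rule barreled_imp_equicontinuous[OF barreled])
    show "\<exists>M. \<forall>f\<in>B. \<bar>cdual_apply f y\<bar> \<le> M" for y
      using tvs_bounded_imp_functional_bounded[OF WB T(1) linear_cdual_eval T(2)] B_def by metis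
  qed
  \<comment> \<open>Membership in the polar \<open>D\<close> with factor
    \<open>4 / \<epsilon>\<close> means that \<open>z\<close> and \<open>y\<close> differ by at most
    \<open>\<epsilon> / 4\<close> under every functional in \<open>B\<close>. Density supplies such
    a \<open>z\<close> in \<open>span K\<close>.\<close>
  have "\<exists>k\<in>K. \<exists>z. (4 / \<epsilon>) *\<^sub>R (z - y) \<in> D \<and>
      (\<forall>f\<in>dual_cone K. \<bar>cdual_apply f z\<bar> \<le> cdual_apply f k)" for y
  proof -
    have "\<forall>\<^sub>F z in nhds y. (4 / \<epsilon>) *\<^sub>R (z - y) \<in> D"
      by (rule eventually_affine_nhds[OF lc D])
    then obtain U where "open U" "y \<in> U" "\<And>z. z \<in> U \<Longrightarrow> (4 / \<epsilon>) *\<^sub>R (z - y) \<in> D"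
      unfolding eventually_nhds by blast
    moreover obtain z where "z \<in> U" "z \<in> span K"
      using dense \<open>open U\<close> \<open>y \<in> U\<close> open_Int_closure_eq_empty[of U "span K"] by blast
    ultimately show ?thesis
      using span_dominated_on_dual_cone[OF K \<open>z \<in> span K\<close>] by metis
  qed
  then obtain k z where k: "\<And>y. k y \<in> K" and z: "\<And>y. (4 / \<epsilon>) *\<^sub>R (z y - y) \<in> D"
    and kz: "\<And>y f. f \<in> dual_cone K \<Longrightarrow> \<bar>cdual_apply f (z y)\<bar> \<le> cdual_apply f (k y)"
    by metis
  \<comment> \<open>On the dual cone all summands are nonnegative, so the single point
    \<open>x\<close> dominates every \<open>k y\<close>.\<close>
  define x where "x = (\<Sum>y\<in>F. k y)"
  have "x \<in> K"
    unfolding x_def using F(1)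
    by induction (auto intro: k convex_cone_contains_0[OF K] convex_cone_add[OF K])
  moreover have "f \<in> W" if f: "f \<in> dual_cone K" "cdual_apply f x < \<epsilon> / 2" for f
  proof (rule ccontr)
    assume "f \<notin> W"
    then obtain y' where y': "y' \<in> F" "\<epsilon> \<le> \<bar>cdual_apply f y'\<bar>" using F(3) by force
    define M where "M = Max ((\<lambda>y. \<bar>cdual_apply f y\<bar>) ` F)"
    have le_M: "\<bar>cdual_apply f y\<bar> \<le> M" if "y \<in> F" for y
      unfolding M_def using F(1) that by simp
    have "M \<in> (\<lambda>y. \<bar>cdual_apply f y\<bar>) ` F"
      unfolding M_def using F(1) y'(1) by (intro Max_in) auto
    then obtain y where y: "y \<in> F" "\<bar>cdual_apply f y\<bar> = M" by auto
    have M: "\<epsilon> \<le> M" using le_M y' by fastforce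
    \<comment> \<open>Scaling brings the largest value on \<open>F\<close> to
      \<open>3 \<epsilon> / 4\<close>, so \<open>s f\<close> lies in \<open>B\<close>. At
      \<open>y\<close> this value is at most \<open>\<epsilon> / 4\<close> from the approximation by
      \<open>z y\<close>, plus \<open>s \<bar>f (z y)\<bar> < \<epsilon> / 2\<close> from domination
      by \<open>x\<close> and \<open>s \<le> 1\<close>: a contradiction.\<close>
    define s where "s = 3 * \<epsilon> / (4 * M)"
    have s: "0 < s" "s \<le> 1" "s * M = 3 / 4 * \<epsilon>"
      using M F(2) by (auto simp: s_def field_simps)
    have "s * \<bar>cdual_apply f y'\<bar> < \<epsilon>" if "y' \<in> F" for y'
      using mult_left_mono[OF le_M[OF that], of s] s F(2) by simp
    then have "s *\<^sub>R f \<in> W"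
      using F(3) s(1) by (auto simp: scaleR_cdual.rep_eq abs_mult)
    moreover have "s *\<^sub>R f \<in> dual_cone K"
      using conic_dual_cone[of K] f(1) s(1) by (auto simp: conic_def)
    ultimately have "\<bar>cdual_apply (s *\<^sub>R f) ((4 / \<epsilon>) *\<^sub>R (z y - y))\<bar> \<le> 1"
      using z[of y] by (auto simp: D_def B_def)
    moreover have "cdual_apply (s *\<^sub>R f) ((4 / \<epsilon>) *\<^sub>R (z y - y)) =
        s * (4 / \<epsilon>) * (cdual_apply f (z y) - cdual_apply f y)"
      by (simp only: scaleR_cdual.rep_eq linear_cmul[OF linear_cdual_apply]
          linear_diff[OF linear_cdual_apply] real_scaleR_def mult.assoc)
    ultimately have "s * (4 / \<epsilon>) * \<bar>cdual_apply f (z y) - cdual_apply f y\<bar> \<le> 1"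
      using s(1) F(2) by (simp only: abs_mult abs_divide abs_of_pos abs_numeral)
    then have "s * \<bar>cdual_apply f (z y) - cdual_apply f y\<bar> \<le> \<epsilon> / 4"
      using F(2) by (simp add: field_simps)
    moreover have "s * M \<le> s * \<bar>cdual_apply f (z y) - cdual_apply f y\<bar> + s * \<bar>cdual_apply f (z y)\<bar>"
      using s(1) y(2) by (simp flip: distrib_left)
    moreover have "s * \<bar>cdual_apply f (z y)\<bar> < \<epsilon> / 2"
    proof -
      have "s * \<bar>cdual_apply f (z y)\<bar> \<le> \<bar>cdual_apply f (z y)\<bar>"
        using s by (simp add: mult_left_le_one_le)
      also have "\<dots> \<le> cdual_apply f (k y)" by (rule kz[OF f(1)])
      also have "\<dots> \<le> (\<Sum>y\<in>F. cdual_apply f (k y))"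
        using f(1) k F(1) y(1) by (intro member_le_sum) (auto simp: dual_cone_def)
      also have "\<dots> = cdual_apply f x"
        by (simp add: x_def linear_sum[OF linear_cdual_apply])
      finally show ?thesis using f(2) by simp
    qed
    ultimately show False using s(3) by simp
  qed
  then have "tvs_bounded T ({f. cdual_apply f x < \<epsilon> / 2} \<inter> dual_cone K)"
    by (intro tvs_bounded_subset[OF WB]) auto
  ultimately show ?thesis using F(2) that[of x "\<epsilon> / 2"] by simp
qed

text \<open>If \<open>f\<close> and \<open>- f\<close> lie in the cone, the constant nets at
  \<open>f\<close> and \<open>- f\<close> have midpoint 0, so the constant \<open>f\<close>
  converges weak-star to 0. A one-element index set is enough.\<close>

lemma s_ext_imp_pointed_dual_cone:
  fixes K :: "'a::{real_vector, topological_space} set"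
  assumes T: "0 \<in> topspace T" and ext: "0 \<in> s_ext weak_star_topology T (dual_cone K)"
  shows "pointed (dual_cone K)"
proof -
  have "f = 0" if f: "f \<in> dual_cone K" "- f \<in> dual_cone K" for f
  proof -
    have D: "directed_set {{} :: 'a cdual set} (\<lambda>_ _. True)" by (simp add: directed_set_def)
    have lim: "limitin weak_star_topology (\<lambda>_. f) 0 (net_filter {{} :: 'a cdual set} (\<lambda>_ _. True))"
      using f T by (intro s_ext_nets[OF ext D, where c' = "\<lambda>_. - f"]) (auto simp: limitin_def)
    have "cdual_apply f y = 0" for y
    proof (rule ccontr)
      assume "cdual_apply f y \<noteq> 0"
      then have "0 \<in> weak_star_topology interior_of {g. \<forall>y\<in>{y}. \<bar>cdual_apply g y\<bar> < \<bar>cdual_apply f y\<bar>}"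
        unfolding weak_star_nhds_zero_iff
        by (intro exI[of _ "{y}"] exI[of _ "\<bar>cdual_apply f y\<bar>"]) auto
      then obtain U where "openin weak_star_topology U" "0 \<in> U"
        "U \<subseteq> {g. \<bar>cdual_apply g y\<bar> < \<bar>cdual_apply f y\<bar>}"
        by (auto simp: interior_of_def)
      moreover from this lim have "f \<in> U"
        by (auto simp: limitin_def eventually_net_filter[OF D])
      ultimately show False by blast
    qed
    then show ?thesis by (simp add: cdual_eq_0_iff)
  qed
  then show ?thesis
    using zero_in_dual_cone[of K] unfolding pointed_def by (auto simp: image_iff)
qed

text \<open>Nonnegativity of the dominating \<open>\<phi>\<close> keeps \<open>\<phi> (c d)\<close>
  between 0 and \<open>\<phi> (c d) + \<phi> (c' d)\<close>, which tends to 0; domination then makes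
  every evaluation of \<open>c d\<close> tend to 0.\<close>

lemma weak_property_pi_imp_s_ext:
  fixes K :: "'a::{real_vector, topological_space} set"
  assumes T: "0 \<in> topspace T" "\<And>y. continuous_map T euclideanreal (\<lambda>f. cdual_apply f y)"
    and pi: "weak_property_pi T (dual_cone K)"
  shows "0 \<in> s_ext weak_star_topology T (dual_cone K)"
proof -
  let ?P = "dual_cone K"
  obtain \<phi> where \<phi>: "linear \<phi>" "continuous_map T euclideanreal \<phi>" "\<And>p. p \<in> ?P \<Longrightarrow> 0 \<le> \<phi> p"
    and dom: "\<And>\<psi>. linear \<psi> \<Longrightarrow> continuous_map T euclideanreal \<psi> \<Longrightarrow> \<exists>C. \<forall>p\<in>?P. \<bar>\<psi> p\<bar> \<le> C * \<phi> p"
    using weak_property_pi_dominating_functional[OF pi conic_dual_cone T(1)] by blast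
  have "limitin weak_star_topology c 0 (net_filter D le)"
    if D: "directed_set D le" and c: "\<forall>d\<in>D. c d \<in> ?P \<and> c' d \<in> ?P"
      and lim: "limitin T (\<lambda>d. (1 / 2) *\<^sub>R (c d + c' d)) 0 (net_filter D le)"
    for D :: "'a cdual set set" and le c c'
  proof -
    \<comment> \<open>The nets are constrained only on \<open>D\<close>, so the pointwise estimates
      hold eventually rather than everywhere.\<close>
    have inD: "\<forall>\<^sub>F d in net_filter D le. d \<in> D"
      unfolding eventually_net_filter[OF D] using D unfolding directed_set_def by blast
    have "limitin euclideanreal (\<phi> \<circ> (\<lambda>d. (1 / 2) *\<^sub>R (c d + c' d))) (\<phi> 0) (net_filter D le)"
      by (rule continuous_map_limit[OF \<phi>(2) lim])
    then have "((\<lambda>d. (1 / 2) * (\<phi> (c d) + \<phi> (c' d))) \<longlongrightarrow> 0) (net_filter D le)"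
      by (simp add: o_def linear_cmul[OF \<phi>(1)] linear_add[OF \<phi>(1)] linear_0[OF \<phi>(1)])
    then have lim2: "((\<lambda>d. 2 * ((1 / 2) * (\<phi> (c d) + \<phi> (c' d)))) \<longlongrightarrow> 0) (net_filter D le)"
      by (rule tendsto_mult_right_zero)
    have lim\<phi>: "((\<lambda>d. \<phi> (c d)) \<longlongrightarrow> 0) (net_filter D le)"
      by (rule tendsto_sandwich[OF _ _ tendsto_const lim2];
          rule eventually_mono[OF inD]) (use c \<phi>(3) in auto)
    have lim_pt: "((\<lambda>d. cdual_apply (c d) y) \<longlongrightarrow> 0) (net_filter D le)" for y
    proof -
      obtain C where C: "\<And>p. p \<in> ?P \<Longrightarrow> \<bar>cdual_apply p y\<bar> \<le> C * \<phi> p"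
        using dom[OF linear_cdual_eval T(2)] by blast
      show ?thesis
        by (rule Lim_null_comparison[OF _ tendsto_mult_right_zero[OF lim\<phi>, of C]],
            rule eventually_mono[OF inD]) (use c C in auto)
    qed
    show ?thesis
      unfolding limitin_def
    proof (intro conjI allI impI)
      show "0 \<in> topspace (weak_star_topology :: 'a cdual topology)"
        by (simp add: weak_star_topology_def topspace_pullback_topology)
      fix U :: "'a cdual set" assume "openin weak_star_topology U \<and> 0 \<in> U"
      then have "0 \<in> weak_star_topology interior_of U" by (simp add: interior_of_openin)
      then obtain F \<epsilon> where F: "finite F" "0 < \<epsilon>" "{f. \<forall>y\<in>F. \<bar>cdual_apply f y\<bar> < \<epsilon>} \<subseteq> U"
        by (auto simp: weak_star_nhds_zero_iff)
      have "\<forall>\<^sub>F d in net_filter D le. \<forall>y\<in>F. \<bar>cdual_apply (c d) y\<bar> < \<epsilon>"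
        using F(1,2) tendstoD[OF lim_pt F(2)] by (intro eventually_ball_finite) auto
      then show "\<forall>\<^sub>F d in net_filter D le. c d \<in> U"
        by (rule eventually_mono) (use F(3) in auto)
    qed
  qed
  then show ?thesis by (auto simp: s_ext_def zero_in_dual_cone)
qed

section \<open>The cycle (i), (ii), (iv), (iii), (v), (i) of implications\<close>

theorem theorem3p16:
  fixes K :: "'a::{real_vector, t2_space} set"
    and T :: "'a cdual topology"
  assumes "locally_convex_topology (euclidean :: 'a topology)"
    and "barreled (euclidean :: 'a topology)"
    and "convex_cone K"
    and "locally_convex_topology T"
    and "dual_pair_compatible T"
  shows "let
      i = weak_property_pi T (dual_cone K);
      ii = 0 \<in> bPC weak_star_topology T (dual_cone K) \<inter> s_ext weak_star_topology T (dual_cone K);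
      iii = (0 \<in> bPC weak_star_topology T (dual_cone K) \<and> closure (span K) = UNIV);
      iv = (0 \<in> bPC weak_star_topology T (dual_cone K) \<and> pointed (dual_cone K));
      v = (\<exists>n\<ge>1. \<exists>x :: nat \<Rightarrow> 'a. (\<forall>j\<in>{1..n}. x j \<in> K) \<and>
            (\<exists>r>0. tvs_bounded T
              ((\<Inter>j\<in>{1..n}. {f. cdual_apply f (x j) < r}) \<inter> dual_cone K)))
    in (i \<longleftrightarrow> ii) \<and> (i \<longleftrightarrow> iii) \<and> (i \<longleftrightarrow> iv) \<and> (i \<longleftrightarrow> v)"
proof -
  let ?P = "dual_cone K"
  let ?i = "weak_property_pi T ?P"
  let ?b = "0 \<in> bPC weak_star_topology T ?P"
  let ?e = "0 \<in> s_ext weak_star_topology T ?P"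
  let ?v = "\<exists>n\<ge>1. \<exists>x :: nat \<Rightarrow> 'a. (\<forall>j\<in>{1..n}. x j \<in> K) \<and>
    (\<exists>r>0. tvs_bounded T ((\<Inter>j\<in>{1..n}. {f. cdual_apply f (x j) < r}) \<inter> ?P))"
  have T0: "0 \<in> topspace T" using assms(4) by (simp add: locally_convex_topology_def)
  have cont: "continuous_map T euclideanreal (\<lambda>f. cdual_apply f y)" for y
    using assms(5) unfolding dual_pair_compatible_def by blast
  have i_b: ?b if ?i
  proof -
    obtain \<phi> \<alpha> where \<phi>: "linear \<phi>" "continuous_map T euclideanreal \<phi>" "0 < \<alpha>"
        "tvs_bounded T (?P \<inter> {p. \<phi> p \<le> \<alpha>})"
      using \<open>?i\<close> unfolding weak_property_pi_def by blast
    then obtain x where x: "\<phi> = (\<lambda>f. cdual_apply f x)"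
      using assms(5) unfolding dual_pair_compatible_def by blast
    \<comment> \<open>Compatibility has made \<open>\<phi>\<close> an evaluation, so its sublevel
      set contains the weak-star neighbourhood \<open>\<bar>f x\<bar> < \<alpha>\<close>.\<close>
    have "0 \<in> weak_star_topology interior_of {p. \<phi> p \<le> \<alpha>}"
      unfolding weak_star_nhds_zero_iff
      using \<phi>(3) by (intro exI[of _ "{x}"] exI[of _ \<alpha>]) (auto simp: x)
    then show ?thesis using \<phi>(4) by (auto simp: bPC_def zero_in_dual_cone)
  qed
  have i_e: ?e if ?i
    by (rule weak_property_pi_imp_s_ext[OF T0 cont that])
  have e_pointed: "pointed ?P" if ?e
    by (rule s_ext_imp_pointed_dual_cone[OF T0 that])
  have pointed_dense: "closure (span K) = UNIV" if "pointed ?P"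
    by (rule pointed_dual_cone_imp_dense_span[OF assms(1) that])
  have dense_v: ?v if bd: ?b "closure (span K) = UNIV"
  proof -
    obtain x r where "x \<in> K" "0 < r" "tvs_bounded T ({f. cdual_apply f x < r} \<inter> ?P)"
      using bounded_slice_of_dense_span[OF assms(1-3) T0 cont bd] by blast
    then show ?thesis by (intro exI[of _ 1] conjI exI[of _ "\<lambda>_. x"] exI[of _ r]) auto
  qed
  have v_i: ?i if ?v
  proof -
    obtain n x r where x: "\<And>j. j \<in> {1..n} \<Longrightarrow> x j \<in> K" and r: "0 < r"
      and B: "tvs_bounded T ((\<Inter>j\<in>{1..n::nat}. {f. cdual_apply f (x j) < r}) \<inter> ?P)"
      using \<open>?v\<close> by blast
    let ?x = "\<Sum>j\<in>{1..n}. x j"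
    have le: "cdual_apply p (x j) \<le> cdual_apply p ?x" if "p \<in> ?P" "j \<in> {1..n}" for p j
      unfolding linear_sum[OF linear_cdual_apply]
      using that x by (intro member_le_sum) (auto simp: dual_cone_def)
    \<comment> \<open>On the dual cone the sum bounds each of its terms; \<open>r / 2\<close> turns
      the weak inequality of the slice into the strict bound \<open>r\<close>.\<close>
    have "tvs_bounded T (?P \<inter> {p. cdual_apply p ?x \<le> r / 2})"
      using le r by (intro tvs_bounded_subset[OF B]) fastforce
    moreover have "0 \<le> cdual_apply p ?x" if "p \<in> ?P" for p
      unfolding linear_sum[OF linear_cdual_apply]
      using that x by (intro sum_nonneg) (auto simp: dual_cone_def)
    ultimately show ?thesis
      unfolding weak_property_pi_def using r linear_cdual_eval cont
      by (intro exI[of _ "\<lambda>f. cdual_apply f ?x"] conjI exI[of _ "r / 2"]) auto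
  qed
  \<comment> \<open>The bPC condition shared by (ii), (iii) and (iv) is derived once from (i) and
    carried along the cycle; only the second condition changes.\<close>
  show ?thesis
    unfolding Let_def Int_iff using i_b i_e e_pointed pointed_dense dense_v v_i by argo
qed

end
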